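(* Let $C$ be a $2$-torsion free commutative ring with unity, let $A$ be an algebra over $C$, and let $f,g,h:A\to A$ be $C$-linear maps such that $f$ is a left $\{g,h\}$-derivation of $A$. For $F\in\{f,g,h\}$ define $\widetilde{F}:A[x]\to A[x]$ by $\widetilde{F}\big(\sum_{j=0}^{r}a_jx^j\big)=\sum_{j=0}^{r}F(a_j)x^j$ for $a_j\in A$. Then $\widetilde{f}$ is a left $\{\widetilde{g},\widetilde{h}\}$-derivation of the $C$-algebra $A[x]$.
   Context: A ring $R$ is $2$-torsion free if $2a=0$ with $a\in R$ implies $a=0$. For an algebra $B$ over $C$ and $C$-linear maps $f,g,h:B\to B$, $f$ is a left $\{g,h\}$-derivation if $f(ab)=a\,g(b)+b\,h(a)=a\,h(b)+b\,g(a)$ for all $a,b\in B$. $A[x]$ is the polynomial ring over $A$ (with $x$ commuting with the elements of $A$), viewed as a $C$-algebra with coefficientwise scalar multiplication. *)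

theory Defs
  imports Complex_Main "HOL-Library.Poly_Mapping"
begin

definition two_torsion_free :: "'a::ring_1 itself \<Rightarrow> bool"
  where "two_torsion_free _ \<longleftrightarrow> (\<forall>a::'a. 2 * a = 0 \<longrightarrow> a = 0)"

text \<open>Class \<open>ring\<close> is associative; neither commutativity nor a unit is required of the algebra.\<close>

locale algebra_over = module scale
  for scale :: "'c::comm_ring_1 \<Rightarrow> 'a::ring \<Rightarrow> 'a" +
  assumes scale_mult_left: "scale c (a * b) = scale c a * b"
    and scale_mult_right: "scale c (a * b) = a * scale c b"

locale left_gh_derivation =
  algebra_over scale +
  f: module_hom scale scale f +
  g: module_hom scale scale g +
  h: module_hom scale scale h
  for scale :: "'c::comm_ring_1 \<Rightarrow> 'a::ring \<Rightarrow> 'a" and f g h +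
  assumes deriv_gh: "f (a * b) = a * g b + b * h a"
    and deriv_hg: "f (a * b) = a * h b + b * g a"

text \<open>
  The multiplication of type \<open>'a poly\<close> requires commutative coefficients, so \<open>A[x]\<close> is
  \<open>nat \<Rightarrow>\<^sub>0 'a\<close>, a ring under convolution for every \<open>'a::ring\<close>. The monomial \<open>a x^j\<close> is
  \<open>Poly_Mapping.single j a\<close>, and \<open>mult_single\<close> expresses that \<open>x\<close> commutes with coefficients.
\<close>

definition poly_lift :: "('a::ring \<Rightarrow> 'a) \<Rightarrow> (nat \<Rightarrow>\<^sub>0 'a) \<Rightarrow> (nat \<Rightarrow>\<^sub>0 'a)"
  where "poly_lift F p =
    (\<Sum>j\<in>Poly_Mapping.keys p. Poly_Mapping.single j (F (Poly_Mapping.lookup p j)))"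

lemma lookup_poly_lift:
  assumes "F 0 = 0"
  shows "Poly_Mapping.lookup (poly_lift F p) k = F (Poly_Mapping.lookup p k)"
  using assms
  by (auto simp: poly_lift_def lookup_sum lookup_single when_def in_keys_iff)

text \<open>
  The coefficient list of a polynomial may be padded with zeros, so the next equation shows that
  \<open>poly_lift F\<close> does not depend on how the polynomial is written when \<open>F 0 = 0\<close>.
\<close>

lemma poly_lift_sum_single:
  assumes "F 0 = 0"
  shows "poly_lift F (\<Sum>j\<le>r. Poly_Mapping.single j (a j)) =
    (\<Sum>j\<le>r. Poly_Mapping.single j (F (a j)))"
  using assms
  by (intro poly_mapping_eqI)
    (auto simp: lookup_poly_lift lookup_sum lookup_single when_def)

definition poly_scale :: "('c \<Rightarrow> 'a::ring \<Rightarrow> 'a) \<Rightarrow> 'c \<Rightarrow> (nat \<Rightarrow>\<^sub>0 'a) \<Rightarrow> (nat \<Rightarrow>\<^sub>0 'a)"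
  where "poly_scale scale c = poly_lift (scale c)"

end

theory Submission imports Defs begin

text \<open>Both sides of each derivation identity are additive in \<open>p\<close> and in
  \<open>q\<close>, so it suffices to compare them on monomials. For a x^i and b x^j every product
  has degree i + j, and the identity becomes the given one in A, applied to the coefficients a and
  b. \<open>poly_mapping_additive_induct\<close> provides the reduction to monomials and
  \<open>poly_lift_mult_eq\<close> carries out the comparison. The algebra laws of A[x] are reduced
  in the same way, while linearity of the lifted maps is read off coefficientwise.\<close>

text \<open>A finitely supported function is the finite sum of its monomials; \<open>zero\<close>
  covers the empty sum.\<close>

lemma poly_mapping_additive_induct [case_names zero single add]:
  fixes p :: "'k \<Rightarrow>\<^sub>0 'a::comm_monoid_add"
  assumes zero: "P 0"
    and single: "\<And>k a. P (Poly_Mapping.single k a)"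
    and add: "\<And>p q. P p \<Longrightarrow> P q \<Longrightarrow> P (p + q)"
  shows "P p"
proof -
  have "P (\<Sum>k\<in>K. Poly_Mapping.single k (Poly_Mapping.lookup p k))" if "finite K" for K
    using that by induction (simp_all add: zero single add)
  moreover have "p = (\<Sum>k\<in>Poly_Mapping.keys p. Poly_Mapping.single k (Poly_Mapping.lookup p k))"
    by (intro poly_mapping_eqI) (auto simp: lookup_sum lookup_single when_def in_keys_iff)
  ultimately show ?thesis
    by (metis finite_keys)
qed

lemma poly_lift_zero: "poly_lift F 0 = 0"
  by (simp add: poly_lift_def)

lemma poly_lift_single:
  assumes "F 0 = 0"
  shows "poly_lift F (Poly_Mapping.single j a) = Poly_Mapping.single j (F a)"
  using assms
  by (intro poly_mapping_eqI) (auto simp: lookup_poly_lift lookup_single when_def)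

lemma poly_lift_add:
  assumes "F 0 = 0" and "\<And>a b. F (a + b) = F a + F b"
  shows "poly_lift F (p + q) = poly_lift F p + poly_lift F q"
  using assms by (intro poly_mapping_eqI) (simp add: lookup_poly_lift lookup_add)

text \<open>Stated for arbitrary additive maps, so that both identities of a left {g,h}-derivation
  are instances.\<close>

lemma poly_lift_mult_eq:
  fixes F G H :: "'a::ring \<Rightarrow> 'a"
  assumes F: "F 0 = 0" "\<And>a b. F (a + b) = F a + F b"
    and G: "G 0 = 0" "\<And>a b. G (a + b) = G a + G b"
    and H: "H 0 = 0" "\<And>a b. H (a + b) = H a + H b"
    and FGH: "\<And>a b. F (a * b) = a * G b + b * H a"
  shows "poly_lift F (p * q) = p * poly_lift G q + q * poly_lift H p"
proof (induction p rule: poly_mapping_additive_induct)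
  case zero
  then show ?case by (simp add: poly_lift_zero)
next
  case (single i a)
  show ?case
  proof (induction q rule: poly_mapping_additive_induct)
    case zero
    then show ?case by (simp add: poly_lift_zero)
  next
    case (single j b)
    \<comment> \<open>Only the exponents i + j and j + i have to be matched by commutativity; the
      order of the coefficients in \<open>b * H a\<close> stays fixed, since A may be
      noncommutative.\<close>
    then show ?case
      by (simp add: poly_lift_single F(1) G(1) H(1) mult_single FGH single_add add.commute)
  next
    case (add q q')
    then show ?case
      by (simp add: poly_lift_add F G H algebra_simps)
  qed
next
  case (add p p')
  then show ?case
    by (simp add: poly_lift_add F G H algebra_simps)
qed

context algebra_over
begin

lemma module_poly_scale: "module (poly_scale scale)"
  by unfold_locales
    (auto intro!: poly_mapping_eqI
      simp: poly_scale_def lookup_poly_lift lookup_add scale_left_distrib scale_right_distrib)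

text \<open>Scaling by c is additive on A[x], so both compatibility laws are biadditive in the two
  factors; on monomials they are the laws of A.\<close>

lemma algebra_over_poly_scale: "algebra_over (poly_scale scale)"
proof -
  interpret P: module "poly_scale scale"
    by (rule module_poly_scale)
  have scale_single: "poly_scale scale c (Poly_Mapping.single k a) = Poly_Mapping.single k (scale c a)"
    for c k a
    by (simp add: poly_scale_def poly_lift_single)
  show ?thesis
  proof
    fix c p q
    show "poly_scale scale c (p * q) = poly_scale scale c p * q"
    proof (induction p rule: poly_mapping_additive_induct)
      case (single i a)
      show ?case
        by (induction q rule: poly_mapping_additive_induct)
          (simp_all add: scale_single mult_single scale_mult_left P.scale_right_distrib distrib_left)
    qed (simp_all add: P.scale_right_distrib distrib_right)
    show "poly_scale scale c (p * q) = p * poly_scale scale c q"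
    proof (induction p rule: poly_mapping_additive_induct)
      case (single i a)
      show ?case
        by (induction q rule: poly_mapping_additive_induct)
          (simp_all add: scale_single mult_single scale_mult_right P.scale_right_distrib distrib_left)
    qed (simp_all add: P.scale_right_distrib distrib_right)
  qed
qed

lemma module_hom_poly_lift:
  assumes "module_hom scale scale F"
  shows "module_hom (poly_scale scale) (poly_scale scale) (poly_lift F)"
proof -
  interpret F: module_hom scale scale F by (rule assms)
  interpret P: module "poly_scale scale" by (rule module_poly_scale)
  show ?thesis
    by unfold_locales
      (auto intro!: poly_mapping_eqI
        simp: poly_scale_def lookup_poly_lift lookup_add F.zero F.add F.scale)
qed

end

theorem theorem4p1:
  fixes scale :: "'c::comm_ring_1 \<Rightarrow> 'a::ring \<Rightarrow> 'a"
    and f g h :: "'a \<Rightarrow> 'a"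
  assumes "two_torsion_free TYPE('c)"
    and "algebra_over scale"
    and "module_hom scale scale f"
    and "module_hom scale scale g"
    and "module_hom scale scale h"
    and "left_gh_derivation scale f g h"
  shows "left_gh_derivation (poly_scale scale) (poly_lift f) (poly_lift g) (poly_lift h)"
proof -
  interpret left_gh_derivation scale f g h by (rule assms)
  note hom = module_hom_poly_lift[OF assms(3)] module_hom_poly_lift[OF assms(4)]
    module_hom_poly_lift[OF assms(5)]
  show ?thesis
  proof (intro left_gh_derivation.intro left_gh_derivation_axioms.intro
      algebra_over_poly_scale hom)
    fix p q
    show "poly_lift f (p * q) = p * poly_lift g q + q * poly_lift h p"
      by (rule poly_lift_mult_eq)
        (rule f.zero f.add g.zero g.add h.zero h.add deriv_gh)+
    \<comment> \<open>The same lemma with the roles of \<open>g\<close> and \<open>h\<close>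
      exchanged, now fed by \<open>deriv_hg\<close>.\<close>
    show "poly_lift f (p * q) = p * poly_lift h q + q * poly_lift g p"
      by (rule poly_lift_mult_eq)
        (rule f.zero f.add g.zero g.add h.zero h.add deriv_hg)+
  qed
qed

end
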